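(* Let $k\ge 0$ be an integer and let $f$ be a function having $k+2$ derivatives in the interval $[0,1]$. Then $$\int_{0}^{1}x^k f\left(\left\{\frac{1}{x}\right\}\right)dx=\frac{1}{(k+1)!}\Bigg(\sum_{j=0}^{k}(k-j)!\Big(f^{(j)}(0)\,\alpha_{k-j}-f^{(j)}(1)\,(\alpha_{k-j}-1)\Big)+\int_{0}^{1}f^{(k+2)}(x)\log\Gamma(x+1)\,dx\Bigg).$$
   Context: $\{t\}=t-\lfloor t\rfloor$ denotes the fractional part of the real number $t$. The sequence $\alpha_n$ is defined by $\alpha_0=\gamma$ (the Euler--Mascheroni constant) and $\alpha_n=\zeta(n+1)$ for integers $n>0$, where $\zeta$ is the Riemann zeta function. $\Gamma$ is the gamma function. $f^{(j)}$ is the $j$-th derivative of $f$, with $f^{(0)}=f$. *)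

theory Defs
  imports "HOL-Analysis.Analysis"
begin

text \<open>
  Derivatives are taken within the set, so on a closed interval they are one-sided at the
  endpoints and do not depend on the values of the function outside the interval.
\<close>

primrec nth_deriv_within :: "real set \<Rightarrow> nat \<Rightarrow> (real \<Rightarrow> real) \<Rightarrow> real \<Rightarrow> real" where
  "nth_deriv_within S 0 f = f"
| "nth_deriv_within S (Suc j) f =
     (\<lambda>x. vector_derivative (nth_deriv_within S j f) (at x within S))"

text \<open>Only existence of the derivatives is required; the last one need not be continuous.\<close>

definition n_times_differentiable_on :: "nat \<Rightarrow> (real \<Rightarrow> real) \<Rightarrow> real set \<Rightarrow> bool" where
  "n_times_differentiable_on n f S \<longleftrightarrow> (\<forall>j<n. nth_deriv_within S j f differentiable_on S)"

text \<open>The Dirichlet series of the Riemann zeta function; meaningful only for \<open>s > 1\<close>.\<close>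

definition zeta :: "real \<Rightarrow> real" where
  "zeta s = (\<Sum>n. 1 / real (Suc n) powr s)"

definition alpha :: "nat \<Rightarrow> real" where
  "alpha n = (if n = 0 then euler_mascheroni else zeta (real n + 1))"

end

theory Submission
  imports Defs
begin

text \<open>
  The substitution \<open>t = 1 / x - (n + 1)\<close> maps each interval on which \<open>1 / x\<close> has integer part
  \<open>n + 1\<close> onto the unit interval, and \<open>x ^ k dx\<close> becomes \<open>- dt / (t + 1 + n) ^ (k + 2)\<close>.
  Adding up these intervals turns the left-hand integral into the integral of \<open>f\<close> against
  \<open>\<Sum>n. 1 / (t + 1 + n) ^ (k + 2)\<close> (\<open>has_integral_power_mult_frac_inverse\<close>).  This Hurwitz zeta
  value is, up to the factor \<open>(-1) ^ k / (k + 1)!\<close>, the derivative of order \<open>k + 2\<close> of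
  \<open>ln (\<Gamma> (t + 1))\<close>.

  Integrating by parts \<open>k + 2\<close> times (\<open>nth_deriv_within_mult_has_integral\<close>) moves all these
  derivatives onto \<open>f\<close>.  The boundary terms contain polygamma values at 1 and 2, which are
  \<open>alpha m\<close> and \<open>alpha m - 1\<close> up to sign and factorial; the boundary terms with the undifferentiated
  logarithm vanish because \<open>\<Gamma> 1 = \<Gamma> 2 = 1\<close>.

  The highest derivative of \<open>f\<close> may fail to be Lebesgue integrable, so everything is done with
  the Henstock-Kurzweil integral: there every derivative is integrable, and the integration by
  parts is carried out from the smooth side, which yields the integrability of the product with
  the highest derivative as a conclusion.
\<close>

section \<open>Repeated integration by parts\<close>

lemma nth_deriv_within_has_vector_derivative:
  assumes "n_times_differentiable_on n f S" and "j < n" and "x \<in> S"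
  shows "(nth_deriv_within S j f has_vector_derivative nth_deriv_within S (Suc j) f x)
           (at x within S)"
  using assms
  by (auto simp: n_times_differentiable_on_def differentiable_on_def
      simp flip: vector_derivative_works)

text \<open>
  The sequence \<open>u\<close> is a chain of successive derivatives.  Integrability is assumed only for the
  product with all derivatives on \<open>u\<close>; one integration by parts reduces \<open>n + 1\<close> to the induction
  hypothesis for the shifted chain \<open>u 1, u 2, ...\<close>.
\<close>

lemma nth_deriv_within_mult_has_integral:
  fixes f :: "real \<Rightarrow> real" and u :: "nat \<Rightarrow> real \<Rightarrow> real"
  assumes "a \<le> b"
    and "n_times_differentiable_on n f {a..b}"
    and "\<And>i x. i < n \<Longrightarrow> x \<in> {a..b} \<Longrightarrow>
           (u i has_field_derivative u (Suc i) x) (at x within {a..b})"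
    and "(\<lambda>x. f x * u n x) integrable_on {a..b}"
  shows "((\<lambda>x. nth_deriv_within {a..b} n f x * u 0 x) has_integral
           (\<Sum>j<n. (-1) ^ (n - 1 - j) *
              (nth_deriv_within {a..b} j f b * u (n - 1 - j) b
               - nth_deriv_within {a..b} j f a * u (n - 1 - j) a))
           + (-1) ^ n * integral {a..b} (\<lambda>x. f x * u n x)) {a..b}"
  using assms
proof (induction n arbitrary: u)
  case 0
  then show ?case
    by (simp add: integrable_integral)
next
  case (Suc n)
  let ?D = "\<lambda>j. nth_deriv_within {a..b} j f"
  let ?B = "\<lambda>i j. ?D j b * u i b - ?D j a * u i a"
  have dD: "(?D n has_vector_derivative ?D (Suc n) x) (at x within {a..b})" if "x \<in> {a..b}" for x
    using nth_deriv_within_has_vector_derivative[OF Suc.prems(2) _ that] by blast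
  have du: "(u 0 has_vector_derivative u 1 x) (at x within {a..b})" if "x \<in> {a..b}" for x
    using Suc.prems(3)[OF _ that, of 0] by (simp add: has_real_derivative_iff_has_vector_derivative)
  have IH: "((\<lambda>x. ?D n x * u 1 x) has_integral
      (\<Sum>j<n. (-1) ^ (n - 1 - j) * ?B (Suc (n - 1 - j)) j)
      + (-1) ^ n * integral {a..b} (\<lambda>x. f x * u (Suc n) x)) {a..b}" (is "(_ has_integral ?I) _")
    using Suc.IH[of "\<lambda>i. u (Suc i)"] Suc.prems
    by (simp add: n_times_differentiable_on_def)
  have "(\<Sum>j<n. (-1) ^ (n - 1 - j) * ?B (Suc (n - 1 - j)) j) = (\<Sum>j<n. - ((-1) ^ (n - j) * ?B (n - j) j))"
  proof (rule sum.cong)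
    fix j assume "j \<in> {..<n}"
    then have "n - j = Suc (n - 1 - j)" by simp
    then show "(-1) ^ (n - 1 - j) * ?B (Suc (n - 1 - j)) j = - ((-1) ^ (n - j) * ?B (n - j) j)"
      by (simp del: diff_diff_left)
  qed simp
  then have I: "?B 0 n - ?I = (\<Sum>j<Suc n. (-1) ^ (n - j) * ?B (n - j) j)
      + (-1) ^ Suc n * integral {a..b} (\<lambda>x. f x * u (Suc n) x)"
    by (simp add: sum_negf)
  have "((\<lambda>x. ?D (Suc n) x * u 0 x) has_integral (?B 0 n - ?I)) {a..b}"
  proof (rule integration_by_parts_interior[OF bounded_bilinear_mult \<open>a \<le> b\<close>, where g' = "u 1"])
    show "continuous_on {a..b} (?D n)" "continuous_on {a..b} (u 0)"
      unfolding continuous_on_eq_continuous_within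
      by (intro ballI has_vector_derivative_continuous[OF dD] has_vector_derivative_continuous[OF du],
          assumption)+
    show "(?D n has_vector_derivative ?D (Suc n) x) (at x)"
      "(u 0 has_vector_derivative u 1 x) (at x)" if "x \<in> {a<..<b}" for x
      using dD[of x] du[of x] that by (simp_all add: at_within_Icc_at)
  qed (use IH in simp)
  then show ?case
    unfolding I by (simp only: diff_Suc_1)
qed

section \<open>Integrals along the Gauss map\<close>

text \<open>
  The interval is the closure of the set where \<open>1 / x\<close> has integer part \<open>n + 1\<close>, that is, of the
  domain of one branch of the Gauss map \<open>x \<mapsto> frac (1 / x)\<close>.
\<close>

lemma has_integral_Gauss_branch:
  fixes f :: "real \<Rightarrow> real"
  assumes f: "continuous_on {0..1} f"
  shows "((\<lambda>x. x ^ k * f (frac (1 / x))) has_integral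
           integral {0..1} (\<lambda>t. f t * inverse ((t + 1 + real n) ^ (k + 2))))
         {1 / (real n + 2)..1 / (real n + 1)}"
proof -
  let ?a = "1 / (real n + 2)" and ?b = "1 / (real n + 1)"
  let ?g = "\<lambda>x. 1 / x - (real n + 1)"
  let ?h = "\<lambda>t. f t * inverse ((t + 1 + real n) ^ (k + 2))"
  have ab: "?a \<le> ?b" by (intro divide_left_mono) auto
  have pos: "x > 0" if "x \<in> {?a..?b}" for x
    using that by (intro less_le_trans[of 0 ?a x]) auto
  have range: "?g ` {?a..?b} \<subseteq> {0..1}"
  proof (intro image_subsetI)
    fix x assume x: "x \<in> {?a..?b}"
    then have "real n + 1 \<le> 1 / x" "1 / x \<le> real n + 2"
      using pos[OF x] by (simp_all add: pos_le_divide_eq pos_divide_le_eq mult.commute)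
    then show "?g x \<in> {0..1}" by simp
  qed
  have h: "continuous_on {0..1} ?h"
    by (intro continuous_intros f) auto
  have g: "(?g has_field_derivative - (1 / x ^ 2)) (at x within {?a..?b})" if "x \<in> {?a..?b}" for x
    using pos[OF that] by (auto intro!: derivative_eq_intros simp: power2_eq_square)
  have "((\<lambda>x. - (1 / x ^ 2) *\<^sub>R ?h (?g x)) has_integral
          (integral {?g ?a..?g ?b} ?h - integral {?g ?b..?g ?a} ?h)) {?a..?b}"
    using g by (intro has_integral_substitution_general[OF finite.emptyI ab range h]
        DERIV_continuous_on[where D = "\<lambda>x. - (1 / x ^ 2)"]) auto
  from has_integral_neg[OF this]
  have "((\<lambda>x. - (- (1 / x ^ 2) *\<^sub>R ?h (?g x))) has_integral integral {0..1} ?h) {?a..?b}"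
    by simp
  then show ?thesis
    \<comment> \<open>At the left endpoint \<open>1 / x\<close> is the integer \<open>n + 2\<close>, so the fractional part jumps from 1 to 0.\<close>
  proof (rule has_integral_spike_finite[where S = "{?a}", rotated 2])
    fix x assume x: "x \<in> {?a..?b} - {?a}"
    then have "?a < x" "x \<le> ?b" by auto
    moreover have "0 < x" using x pos by auto
    ultimately have "\<lfloor>1 / x\<rfloor> = int n + 1"
      by (intro floor_unique) (simp_all add: field_simps)
    then have frac: "frac (1 / x) = ?g x" by (simp add: frac_def)
    have "x ^ k = 1 / x ^ 2 * inverse ((1 / x) ^ (k + 2))"
      using \<open>0 < x\<close> by (simp add: power_one_over power_add power2_eq_square)
    also have "1 / x = ?g x + 1 + real n" by simp
    finally show "x ^ k * f (frac (1 / x)) = - (- (1 / x ^ 2) *\<^sub>R ?h (?g x))"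
      unfolding frac by simp
  qed simp
qed

text \<open>
  The first \<open>N\<close> branches cover \<open>{1 / (N + 1)..1}\<close>.  Dominated convergence is used on both sides
  as \<open>N\<close> grows: on the left with a constant bound of \<open>f\<close>, on the right with \<open>\<bar>f\<bar> * K\<close>, which
  dominates because the series has positive terms.
\<close>

lemma has_integral_power_mult_frac_inverse:
  fixes f K :: "real \<Rightarrow> real"
  assumes f: "continuous_on {0..1} f" and K: "continuous_on {0..1} K"
    and sums: "\<And>t. t \<in> {0..1} \<Longrightarrow> (\<lambda>n. inverse ((t + 1 + real n) ^ (k + 2))) sums K t"
  shows "((\<lambda>x. x ^ k * f (frac (1 / x))) has_integral integral {0..1} (\<lambda>t. f t * K t)) {0..1}"
proof -
  let ?G = "\<lambda>x. x ^ k * f (frac (1 / x))"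
  let ?S = "\<lambda>N t. \<Sum>n<N. inverse ((t + 1 + real n) ^ (k + 2))"
  have part: "(?G has_integral integral {0..1} (\<lambda>t. f t * ?S N t)) {1 / (real N + 1)..1}" for N
  proof (induction N)
    case (Suc N)
    have "integral {0..1} (\<lambda>t. f t * ?S (Suc N) t) =
        integral {0..1} (\<lambda>t. f t * inverse ((t + 1 + real N) ^ (k + 2)) + f t * ?S N t)"
      by (simp add: algebra_simps)
    also have "\<dots> = integral {0..1} (\<lambda>t. f t * inverse ((t + 1 + real N) ^ (k + 2)))
        + integral {0..1} (\<lambda>t. f t * ?S N t)"
      by (intro integral_add integrable_continuous_real continuous_intros f) auto
    finally show ?case
      using has_integral_combine[OF _ _ has_integral_Gauss_branch[OF f, of k N] Suc]
      by (simp add: field_simps)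
  qed auto
  have lim: "(\<lambda>N. integral {0..1} (\<lambda>t. f t * ?S N t)) \<longlonglongrightarrow> integral {0..1} (\<lambda>t. f t * K t)"
  proof (rule dominated_convergence(2))
    show "(\<lambda>t. f t * ?S N t) integrable_on {0..1}" for N
      by (intro integrable_continuous_real continuous_intros f) auto
    show "(\<lambda>t. \<bar>f t\<bar> * K t) integrable_on {0..1}"
      by (intro integrable_continuous_real continuous_intros f K)
    fix t :: real assume t: "t \<in> {0..1}"
    show "(\<lambda>N. f t * ?S N t) \<longlonglongrightarrow> f t * K t"
      using sums[OF t] by (intro tendsto_intros) (simp add: sums_def)
    show "norm (f t * ?S N t) \<le> \<bar>f t\<bar> * K t" for N
    proof -
      have "?S N t \<le> K t"
      proof -
        have "?S N t \<le> (\<Sum>n. inverse ((t + 1 + real n) ^ (k + 2)))"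
          by (rule sum_le_suminf[OF sums_summable[OF sums[OF t]]]) (use t in auto)
        then show ?thesis using sums_unique[OF sums[OF t]] by simp
      qed
      moreover have "0 \<le> ?S N t" using t by (auto intro!: sum_nonneg)
      ultimately show ?thesis by (auto simp: abs_mult intro!: mult_left_mono)
    qed
  qed
  obtain M where M: "\<bar>f t\<bar> \<le> M" if "t \<in> {0..1}" for t
    using compact_imp_bounded[OF compact_continuous_image[OF f compact_Icc]]
    by (auto simp: bounded_iff simp del: atLeastAtMost_iff)
  \<comment> \<open>The truncated integrands all vanish at 0, whereas \<open>?G 0\<close> is \<open>f 0\<close> for \<open>k = 0\<close>.\<close>
  have "((\<lambda>x. if x = 0 then 0 else ?G x) has_integral integral {0..1} (\<lambda>t. f t * K t)) {0..1}"
  proof (rule has_integral_dominated_convergence[OF _ _ _ _ lim])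
    show "((\<lambda>x. if x \<in> {1 / (real N + 1)..1} then ?G x else 0) has_integral
        integral {0..1} (\<lambda>t. f t * ?S N t)) {0..1}" for N
      using part[of N] by (subst has_integral_restrict) auto
    show "(\<lambda>x. M) integrable_on {0..1::real}" by blast
    have "\<bar>?G x\<bar> \<le> M" if "x \<in> {0..1}" for x
    proof -
      have "\<bar>x ^ k\<bar> * \<bar>f (frac (1 / x))\<bar> \<le> 1 * M"
        using that frac_lt_1[of "1 / x"]
        by (intro mult_mono M) (auto simp: power_le_one)
      then show ?thesis by (simp add: abs_mult)
    qed
    moreover have "0 \<le> M" using M[of 0] by auto
    ultimately show "\<forall>x\<in>{0..1}. norm (if x \<in> {1 / (real N + 1)..1} then ?G x else 0) \<le> M" for N
      by simp
    show "\<forall>x\<in>{0..1}. (\<lambda>N. if x \<in> {1 / (real N + 1)..1} then ?G x else 0)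
        \<longlonglongrightarrow> (if x = 0 then 0 else ?G x)"
    proof
      fix x :: real assume x: "x \<in> {0..1}"
      show "(\<lambda>N. if x \<in> {1 / (real N + 1)..1} then ?G x else 0)
        \<longlonglongrightarrow> (if x = 0 then 0 else ?G x)"
      proof (cases "x = 0")
        case False
        then have "0 < x" using x by auto
        have "(\<lambda>N. 1 / (real N + 1)) \<longlonglongrightarrow> 0"
          using LIMSEQ_inverse_real_of_nat by (simp add: inverse_eq_divide add.commute)
        then have "eventually (\<lambda>N. 1 / (real N + 1) < x) sequentially"
          using \<open>0 < x\<close> by (rule order_tendstoD(2))
        then have "eventually (\<lambda>N. (if x \<in> {1 / (real N + 1)..1} then ?G x else 0) = ?G x) sequentially"
          by eventually_elim (use x in auto)
        then show ?thesis using False by (simp add: tendsto_eventually)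
      qed auto
    qed
  qed
  then show ?thesis
    by (rule has_integral_spike_finite[where S = "{0}", rotated 2]) auto
qed

section \<open>Boundary values and conclusion\<close>

lemma Polygamma_1_eq_alpha:
  "(-1) ^ Suc m * Polygamma m (1::real) = fact m * alpha m"
proof (cases "m = 0")
  case False
  have "inverse ((1 + real n) ^ Suc m) = 1 / real (Suc n) powr (real m + 1)" for n
    using powr_realpow[of "real (Suc n)" "Suc m"] by (simp add: inverse_eq_divide add.commute)
  then have "(\<lambda>n. 1 / real (Suc n) powr (real m + 1)) sums
      ((-1) ^ Suc m * Polygamma m (1::real) / fact m)"
    using Polygamma_LIMSEQ[of "1::real" m] False by (simp only:)
  then have "zeta (real m + 1) = (-1) ^ Suc m * Polygamma m (1::real) / fact m"
    unfolding zeta_def by (rule sums_unique[symmetric])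
  then show ?thesis using False by (simp add: alpha_def)
qed (simp add: alpha_def)

lemma Polygamma_2_eq_alpha:
  "(-1) ^ Suc m * Polygamma m (2::real) = fact m * (alpha m - 1)"
proof -
  have "Polygamma m (2::real) = Polygamma m 1 + (-1) ^ m * fact m"
    using Polygamma_plus1[of "1::real" m] by simp
  then have "(-1) ^ Suc m * Polygamma m (2::real)
      = (-1) ^ Suc m * Polygamma m 1 - ((-1) ^ m * (-1) ^ m) * fact m"
    by (simp add: distrib_left)
  also have "(-1) ^ m * (-1) ^ m = (1::real)"
    by (simp flip: power_mult_distrib)
  finally show ?thesis
    unfolding Polygamma_1_eq_alpha by (simp add: right_diff_distrib)
qed

theorem lemma1:
  fixes k :: nat and f :: "real \<Rightarrow> real"
  assumes "n_times_differentiable_on (k + 2) f {0..1}"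
  shows "(\<lambda>x. x ^ k * f (frac (1 / x))) integrable_on {0..1} \<and>
    (\<lambda>x. nth_deriv_within {0..1} (k + 2) f x * ln (Gamma (x + 1))) integrable_on {0..1} \<and>
    integral {0..1} (\<lambda>x. x ^ k * f (frac (1 / x))) =
      1 / fact (k + 1) *
        ((\<Sum>j=0..k. fact (k - j) *
            (nth_deriv_within {0..1} j f 0 * alpha (k - j)
             - nth_deriv_within {0..1} j f 1 * (alpha (k - j) - 1)))
         + integral {0..1} (\<lambda>x. nth_deriv_within {0..1} (k + 2) f x * ln (Gamma (x + 1))))"
proof -
  let ?D = "\<lambda>j. nth_deriv_within {0..1} j f"
  let ?P = "\<lambda>x::real. Polygamma (k + 1) (x + 1)"
  let ?K = "\<lambda>x. (-1) ^ k * ?P x / fact (k + 1)"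
  let ?L = "\<lambda>x. ?D (k + 2) x * ln (Gamma (x + 1))"
  \<comment> \<open>The successive derivatives of \<open>ln (\<Gamma> (x + 1))\<close>.\<close>
  define u :: "nat \<Rightarrow> real \<Rightarrow> real" where
    "u i x = (case i of 0 \<Rightarrow> ln_Gamma (x + 1) | Suc m \<Rightarrow> Polygamma m (x + 1))" for i x

  have f: "continuous_on {0..1} f"
  proof (rule differentiable_imp_continuous_on)
    have "nth_deriv_within {0..1} 0 f differentiable_on {0..1}"
      using assms unfolding n_times_differentiable_on_def by (elim allE[of _ 0] mp) simp
    then show "f differentiable_on {0..1}" by simp
  qed
  have nonpole: "x + 1 \<notin> \<int>\<^sub>\<le>\<^sub>0" if "x \<in> {0..1}" for x :: real
    using that nonpos_Ints_nonpos[of "x + 1"] by auto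
  have P: "continuous_on {0..1} ?P"
    using nonpole
    by (intro continuous_at_imp_continuous_on ballI isCont_Polygamma continuous_intros) auto
  have K: "continuous_on {0..1} ?K"
    by (intro continuous_intros P) auto
  have int_G: "((\<lambda>x. x ^ k * f (frac (1 / x))) has_integral
      integral {0..1} (\<lambda>x. f x * ?K x)) {0..1}"
  proof (rule has_integral_power_mult_frac_inverse[OF f K])
    fix t :: real assume "t \<in> {0..1}"
    then show "(\<lambda>n. inverse ((t + 1 + real n) ^ (k + 2))) sums ?K t"
      using Polygamma_LIMSEQ[of "t + 1" "k + 1"] by simp
  qed
  have "integral {0..1} (\<lambda>x. f x * ?K x) =
      integral {0..1} (\<lambda>x. ((-1) ^ k / fact (k + 1)) * (f x * ?P x))"
    by (simp add: field_simps)
  also have "\<dots> = (-1) ^ k / fact (k + 1) * integral {0..1} (\<lambda>x. f x * ?P x)"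
    by (rule integral_mult_right)
  finally have K_eq: "(-1) ^ k * integral {0..1} (\<lambda>x. f x * ?P x)
      = fact (k + 1) * integral {0..1} (\<lambda>x. f x * ?K x)"
    by (simp del: fact_Suc)

  have parts: "((\<lambda>x. ?D (k + 2) x * u 0 x) has_integral
      (\<Sum>j<k + 2. (-1) ^ (k + 2 - 1 - j) *
         (?D j 1 * u (k + 2 - 1 - j) 1 - ?D j 0 * u (k + 2 - 1 - j) 0))
      + (-1) ^ (k + 2) * integral {0..1} (\<lambda>x. f x * u (k + 2) x)) {0..1}"
  proof (rule nth_deriv_within_mult_has_integral[OF _ assms])
    show "(u i has_field_derivative u (Suc i) x) (at x within {0..1})"
      if "x \<in> {0..1}" for i x
    proof (cases i)
      case 0
      have "(ln_Gamma has_field_derivative Digamma (x + 1)) (at (x + 1))"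
        using that by (intro has_field_derivative_ln_Gamma_real) auto
      then show ?thesis
        unfolding 0 u_def by (simp add: DERIV_shift has_field_derivative_at_within)
    next
      case (Suc m)
      have "(Polygamma m has_field_derivative Polygamma (Suc m) (x + 1)) (at (x + 1))"
        using nonpole[OF that] by (rule has_field_derivative_Polygamma)
      then show ?thesis
        unfolding Suc u_def by (simp add: DERIV_shift has_field_derivative_at_within)
    qed
    show "(\<lambda>x. f x * u (k + 2) x) integrable_on {0..1}"
      unfolding u_def using P by (auto intro!: integrable_continuous_real continuous_intros f)
  qed simp
  have remainder: "(-1) ^ (k + 2) * integral {0..1} (\<lambda>x. f x * u (k + 2) x)
      = fact (k + 1) * integral {0..1} (\<lambda>x. f x * ?K x)"
    using K_eq by (simp add: u_def)
  have boundary: "(\<Sum>j<k + 2. (-1) ^ (k + 2 - 1 - j) *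
         (?D j 1 * u (k + 2 - 1 - j) 1 - ?D j 0 * u (k + 2 - 1 - j) 0))
      = (\<Sum>j=0..k. - (fact (k - j) * (?D j 0 * alpha (k - j) - ?D j 1 * (alpha (k - j) - 1))))"
  proof -
    have "(-1) ^ (k + 2 - 1 - j) * (?D j 1 * u (k + 2 - 1 - j) 1 - ?D j 0 * u (k + 2 - 1 - j) 0)
        = - (fact (k - j) * (?D j 0 * alpha (k - j) - ?D j 1 * (alpha (k - j) - 1)))"
      if "j \<le> k" for j
    proof -
      have j: "k + 2 - 1 - j = Suc (k - j)" using that by simp
      have "(-1) ^ Suc (k - j) * (?D j 1 * Polygamma (k - j) 2 - ?D j 0 * Polygamma (k - j) 1)
          = ?D j 1 * ((-1) ^ Suc (k - j) * Polygamma (k - j) 2)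
            - ?D j 0 * ((-1) ^ Suc (k - j) * Polygamma (k - j) 1)"
        by (simp add: algebra_simps)
      also have "\<dots> = - (fact (k - j) * (?D j 0 * alpha (k - j) - ?D j 1 * (alpha (k - j) - 1)))"
        unfolding Polygamma_1_eq_alpha Polygamma_2_eq_alpha by (simp add: algebra_simps)
      finally show ?thesis unfolding j by (simp add: u_def)
    qed
    moreover have "u 0 0 = 0" "u 0 1 = 0"
      by (simp_all add: u_def ln_Gamma_real_pos Gamma_numeral)
    moreover have "{..<k + 2} = insert (k + 1) {0..k}" by auto
    ultimately show ?thesis by simp
  qed
  have int_L: "(?L has_integral
      (\<Sum>j=0..k. - (fact (k - j) * (?D j 0 * alpha (k - j) - ?D j 1 * (alpha (k - j) - 1))))
      + fact (k + 1) * integral {0..1} (\<lambda>x. f x * ?K x)) {0..1}"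
    by (rule has_integral_eq[OF _ parts[unfolded remainder boundary]])
       (simp add: u_def ln_Gamma_real_pos)
  show ?thesis
    unfolding integral_unique[OF int_G] integral_unique[OF int_L]
    using has_integral_integrable[OF int_G] has_integral_integrable[OF int_L]
    by (simp add: sum_negf del: fact_Suc nth_deriv_within.simps)
qed

end
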